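(* $\overline{\mathcal{P}}$ is polynomially convex, i.e. for every $x\in\mathbb{C}^3\setminus\overline{\mathcal{P}}$ there is a polynomial $f$ in three variables with $|f|\le1$ on $\overline{\mathcal{P}}$ and $|f(x)|>1$. Moreover $\mathcal{P}$ is polynomially convex in the sense that for every compact $K\subset\mathcal{P}$ the polynomial hull $\widehat K=\{x\in\mathbb{C}^3: |f(x)|\le\sup_K|f| \text{ for all polynomials } f\}$ is contained in $\mathcal{P}$.
   Context: $\mathbb{B}$ is the open unit ball of $\mathbb{C}^{2\times 2}$ (operator norm), $\pi(A)=(a_{21},\operatorname{tr}A,\det A)$, $\mathcal{P}=\pi(\mathbb{B})$, $\overline{\mathcal{P}}$ its closure. *)

theory Defs
  imports "HOL-Analysis.Analysis"
begin

definition Bmat :: "(complex^2^2) set" where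
  "Bmat = {A. onorm (\<lambda>v::complex^2. A *v v) < 1}"

definition piP :: "complex^2^2 \<Rightarrow> complex \<times> complex \<times> complex" where
  "piP A = (A $ 2 $ 1, trace A, det A)"

definition Pset :: "(complex \<times> complex \<times> complex) set" where
  "Pset = piP ` Bmat"

definition poly3 :: "(complex \<times> complex \<times> complex \<Rightarrow> complex) \<Rightarrow> bool" where
  "poly3 f \<longleftrightarrow> (\<exists>(n::nat) (c::nat \<Rightarrow> nat \<Rightarrow> nat \<Rightarrow> complex).
     \<forall>x y z. f (x, y, z) = (\<Sum>i\<le>n. \<Sum>j\<le>n. \<Sum>k\<le>n. c i j k * x ^ i * y ^ j * z ^ k))"

text \<open>Polynomial hull: |f(x)| \<le> sup_K |f| for all polynomials f
  (phrased via all upper bounds M of |f| on K).\<close>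
definition poly_hull :: "(complex \<times> complex \<times> complex) set \<Rightarrow> (complex \<times> complex \<times> complex) set" where
  "poly_hull K = {x. \<forall>f M. poly3 f \<longrightarrow> (\<forall>k\<in>K. norm (f k) \<le> M) \<longrightarrow> norm (f x) \<le> M}"

end

theory Submission
  imports Defs "HOL-Complex_Analysis.Riemann_Mapping"
begin

text \<open>The Moebius transform \<open>(A - w)(1 - cnj w A)\<^sup>-\<^sup>1\<close> of a contraction \<open>A\<close> is a contraction
  with lower left entry \<open>a (1 - |z|\<^sup>2) / (1 - s z + p z\<^sup>2)\<close>, where \<open>(a, s, p) = piP A\<close> and
  \<open>z = cnj w\<close>, so this quotient is bounded by \<open>1\<close>. Conversely, let \<open>s = l + m\<close> and \<open>p = l m\<close>
  with \<open>l\<close>, \<open>m\<close> in the disc. The transform by the hyperbolic midpoint of \<open>l\<close> and \<open>m\<close> makes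
  the trace vanish, and over \<open>(c, 0, q)\<close> with \<open>|c|\<close>, \<open>|q|\<close> at most \<open>1\<close> there is an explicit
  contraction; transforming back gives one over \<open>(a, s, p)\<close>. A point outside the closure of
  \<open>Pset\<close> therefore violates the bound for one \<open>z\<close> or has a root outside the disc. In the first
  case a partial sum of the power series in \<open>z\<close> of the quotient separates it, in the second a
  coefficient of the power series of \<open>1 / (1 - s z + p z\<^sup>2)\<close>. A compact subset of the open set
  \<open>Pset\<close> stays in it after a dilation by some \<open>r > 1\<close>, and the dilation by \<open>1 / r\<close> maps the
  closure into \<open>Pset\<close>.\<close>

subsection \<open>Contractions\<close>

lemma power2_norm_vec: "(norm x)\<^sup>2 = (\<Sum>i\<in>UNIV. (norm (x $ i))\<^sup>2)"
  for x :: "'a::real_normed_vector^'n"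
  by (simp add: norm_vec_def L2_set_def sum_nonneg)

lemma norm_vector_smult: "norm (c *s x) = norm c * norm x"
  for c :: "'a::real_normed_div_algebra"
  by (simp add: norm_vec_def norm_mult L2_set_right_distrib)

lemma mat_vector_mult: "mat c *v x = c *s x" for c :: "'a::semiring_1"
  by (simp add: vec_eq_iff matrix_vector_mult_def mat_def if_distrib[of "\<lambda>t. t * u" for u]
      cong: if_cong)

lemma mat_nth: "mat c $ i $ j = (if i = j then c else 0)"
  by (simp add: mat_def)

lemma mat_matrix_mult_nth: "(mat c ** A) $ i $ j = c * A $ i $ j" for c :: "'a::semiring_1"
  by (simp add: matrix_matrix_mult_def mat_def if_distrib[of "\<lambda>t. t * u" for u] cong: if_cong)

lemma scaleR_matrix_vector_mult: "(r *\<^sub>R A) *v x = r *\<^sub>R (A *v x)"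
  for A :: "'a::real_algebra_1^'n^'m"
  by (simp add: vec_eq_iff matrix_vector_mult_def scaleR_sum_right)

lemma matrix_inv_left:
  assumes "invertible A" shows "matrix_inv A ** A = mat 1"
  using assms unfolding invertible_def matrix_inv_def by (rule someI2_ex) blast

definition contraction :: "complex^'n^'m \<Rightarrow> bool" where
  "contraction A \<longleftrightarrow> (\<forall>x. norm (A *v x) \<le> norm x)"

lemma contraction_norm_le: "contraction A \<Longrightarrow> norm (A *v x) \<le> norm x"
  by (simp add: contraction_def)

lemma contraction_iff_onorm_le: "contraction A \<longleftrightarrow> onorm ((*v) A) \<le> 1"
proof
  assume "contraction A"
  thus "onorm ((*v) A) \<le> 1" by (intro onorm_le) (simp add: contraction_def)
next
  assume onorm_le: "onorm ((*v) A) \<le> 1"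
  show "contraction A"
    unfolding contraction_def
  proof
    fix x
    have "norm (A *v x) \<le> onorm ((*v) A) * norm x"
      by (rule onorm[OF matrix_vector_mul_bounded_linear])
    also have "\<dots> \<le> 1 * norm x" using onorm_le by (intro mult_right_mono) auto
    finally show "norm (A *v x) \<le> norm x" by simp
  qed
qed

lemma contraction_cmod_nth_le:
  assumes "contraction A" shows "cmod (A $ i $ j) \<le> 1"
proof -
  have "A $ i $ j = (A *v axis j 1) $ i"
    by (simp add: matrix_vector_mult_def axis_def if_distrib cong: if_cong)
  also have "cmod \<dots> \<le> norm (A *v axis j 1)" by (rule Finite_Cartesian_Product.norm_nth_le)
  also have "\<dots> \<le> norm (axis j 1 :: complex^_)" by (rule contraction_norm_le[OF assms])
  finally show ?thesis by simp
qed

lemma compact_contractions: "compact {A :: complex^'n^'m. contraction A}"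
  unfolding compact_eq_bounded_closed
proof
  have "norm A \<le> (\<Sum>i\<in>(UNIV :: 'm set). \<Sum>j\<in>(UNIV :: 'n set). 1)"
    if "contraction A" for A :: "complex^'n^'m"
  proof -
    have "norm A \<le> (\<Sum>i\<in>UNIV. norm (A $ i))"
      by (simp add: norm_vec_def L2_set_le_sum)
    also have "\<dots> \<le> (\<Sum>i\<in>UNIV. \<Sum>j\<in>UNIV. cmod (A $ i $ j))"
      by (intro sum_mono) (simp add: norm_vec_def L2_set_le_sum)
    also have "\<dots> \<le> (\<Sum>i\<in>(UNIV :: 'm set). \<Sum>j\<in>(UNIV :: 'n set). 1)"
      by (intro sum_mono contraction_cmod_nth_le that)
    finally show ?thesis .
  qed
  thus "bounded {A :: complex^'n^'m. contraction A}" unfolding bounded_iff by blast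
  have "continuous_on UNIV (\<lambda>A :: complex^'n^'m. A *v x)" for x
    unfolding matrix_vector_mult_def by (intro continuous_intros)
  thus "closed {A :: complex^'n^'m. contraction A}"
    unfolding contraction_def by (intro closed_Collect_all closed_Collect_le continuous_intros)
qed

lemma contraction_if_orthogonal_columns:
  fixes A :: "complex^'n^'m"
  assumes orthogonal: "\<forall>i j. i \<noteq> j \<longrightarrow> (\<Sum>k\<in>UNIV. A $ k $ i * cnj (A $ k $ j)) = 0"
    and columns: "\<forall>i. norm (column i A) \<le> 1"
  shows "contraction A"
  unfolding contraction_def
proof (rule allI, rule power2_le_imp_le)
  fix x
  have "complex_of_real ((norm (A *v x))\<^sup>2)
      = (\<Sum>k\<in>UNIV. \<Sum>i\<in>UNIV. \<Sum>j\<in>UNIV. A $ k $ i * x $ i * cnj (A $ k $ j * x $ j))"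
    unfolding power2_norm_vec of_real_sum complex_norm_square
    by (simp add: matrix_vector_mult_def sum_product)
  also have "\<dots> = (\<Sum>i\<in>UNIV. \<Sum>j\<in>UNIV. \<Sum>k\<in>UNIV. A $ k $ i * x $ i * cnj (A $ k $ j * x $ j))"
    by (subst sum.swap, rule sum.cong[OF refl], rule sum.swap)
  also have "\<dots> = (\<Sum>i\<in>UNIV. \<Sum>j\<in>UNIV. x $ i * cnj (x $ j) * (\<Sum>k\<in>UNIV. A $ k $ i * cnj (A $ k $ j)))"
    by (simp add: sum_distrib_left mult_ac)
  also have "\<dots> = (\<Sum>i\<in>UNIV. \<Sum>j\<in>UNIV.
      if j = i then x $ i * cnj (x $ i) * (\<Sum>k\<in>UNIV. A $ k $ i * cnj (A $ k $ i)) else 0)"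
    using orthogonal by (intro sum.cong refl) auto
  also have "\<dots> = of_real (\<Sum>i\<in>UNIV. (cmod (x $ i))\<^sup>2 * (norm (column i A))\<^sup>2)"
    unfolding power2_norm_vec of_real_sum of_real_mult complex_norm_square
    by (simp add: column_def)
  finally have "(norm (A *v x))\<^sup>2 = (\<Sum>i\<in>UNIV. (cmod (x $ i))\<^sup>2 * (norm (column i A))\<^sup>2)"
    using of_real_eq_iff by blast
  also have "\<dots> \<le> (\<Sum>i\<in>UNIV. (cmod (x $ i))\<^sup>2 * 1)"
    using columns by (intro sum_mono mult_left_mono) (auto simp: power_le_one)
  finally show "(norm (A *v x))\<^sup>2 \<le> (norm x)\<^sup>2" by (simp add: power2_norm_vec)
qed simp

lemma contraction_pencil_invertible:
  fixes A :: "complex^'n^'n"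
  assumes "contraction A" "cmod b < cmod a"
  shows "invertible (mat a - mat b ** A)"
  unfolding invertible_left_inverse matrix_left_invertible_ker
proof (intro allI impI)
  fix x assume "(mat a - mat b ** A) *v x = 0"
  hence "a *s x = b *s (A *v x)"
    by (simp add: matrix_vector_mult_diff_rdistrib matrix_vector_mul_assoc[symmetric]
        mat_vector_mult)
  hence "cmod a * norm x = cmod b * norm (A *v x)" by (metis norm_vector_smult)
  also have "\<dots> \<le> cmod b * norm x"
    by (intro mult_left_mono contraction_norm_le assms norm_ge_zero)
  finally have "(cmod a - cmod b) * norm x \<le> 0" by (simp add: algebra_simps)
  thus "x = 0" using assms(2) by (simp add: mult_le_0_iff)
qed

subsection \<open>Moebius transforms of contractions\<close>

definition matrix_Moebius :: "complex \<Rightarrow> complex^'n^'n \<Rightarrow> complex^'n^'n" where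
  "matrix_Moebius w A = (A - mat w) ** matrix_inv (mat 1 - mat (cnj w) ** A)"

lemma matrix_Moebius_mult:
  assumes "contraction A" "cmod w < 1"
  shows "matrix_Moebius w A ** (mat 1 - mat (cnj w) ** A) = A - mat w"
proof -
  have "invertible (mat 1 - mat (cnj w) ** A)"
    using assms by (intro contraction_pencil_invertible) auto
  thus ?thesis
    unfolding matrix_Moebius_def by (simp add: matrix_mul_assoc[symmetric] matrix_inv_left)
qed

lemma norm_Moebius_le:
  fixes x y :: "complex^'n"
  assumes "norm y \<le> norm x" "cmod w \<le> 1"
  shows "norm (y - w *s x) \<le> norm (x - cnj w *s y)"
proof (rule power2_le_imp_le)
  have pointwise: "(cmod (t - w * u))\<^sup>2 - (cmod (u - cnj w * t))\<^sup>2
      = (1 - (cmod w)\<^sup>2) * ((cmod t)\<^sup>2 - (cmod u)\<^sup>2)" for t u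
    unfolding cmod_power2 by (simp add: algebra_simps power2_eq_square)
  have "(norm (y - w *s x))\<^sup>2 - (norm (x - cnj w *s y))\<^sup>2
      = (1 - (cmod w)\<^sup>2) * ((norm y)\<^sup>2 - (norm x)\<^sup>2)"
    by (simp add: power2_norm_vec sum_subtractf[symmetric] pointwise sum_distrib_left)
  also have "\<dots> \<le> 0"
    using assms by (intro mult_nonneg_nonpos) (auto simp: power_le_one)
  finally show "(norm (y - w *s x))\<^sup>2 \<le> (norm (x - cnj w *s y))\<^sup>2" by simp
qed simp

lemma contraction_matrix_Moebius:
  assumes "contraction A" "cmod w < 1"
  shows "contraction (matrix_Moebius w A)"
  unfolding contraction_def
proof
  fix x
  define X where "X = mat 1 - mat (cnj w) ** A"
  have "invertible X"
    unfolding X_def using assms by (intro contraction_pencil_invertible) auto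
  then obtain y where x_eq: "x = X *v y"
    by (metis invertible_def matrix_vector_mul_assoc matrix_vector_mul_lid)
  have "matrix_Moebius w A *v x = (A - mat w) *v y"
    unfolding x_eq X_def matrix_vector_mul_assoc matrix_Moebius_mult[OF assms] ..
  also have "\<dots> = A *v y - w *s y"
    by (simp add: matrix_vector_mult_diff_rdistrib mat_vector_mult)
  also have "norm \<dots> \<le> norm (y - cnj w *s (A *v y))"
    using assms by (intro norm_Moebius_le contraction_norm_le) auto
  also have "y - cnj w *s (A *v y) = x"
    by (simp add: x_eq X_def matrix_vector_mult_diff_rdistrib matrix_vector_mul_assoc[symmetric]
        mat_vector_mult)
  finally show "norm (matrix_Moebius w A *v x) \<le> norm x" .
qed

subsection \<open>The map piP\<close>

lemma piP_2: "piP A = (A$2$1, A$1$1 + A$2$2, A$1$1 * A$2$2 - A$1$2 * A$2$1)"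
  by (simp add: piP_def trace_def det_2 sum_2)

lemma continuous_on_piP: "continuous_on S piP"
  unfolding piP_2 by (intro continuous_intros)

lemma sum_and_product_of_roots:
  obtains l m :: complex where "s = l + m" "p = l * m"
proof
  let ?d = "csqrt (s\<^sup>2 / 4 - p)"
  show "s = (s / 2 + ?d) + (s / 2 - ?d)" by simp
  have "?d * ?d = s\<^sup>2 / 4 - p" by (metis power2_csqrt power2_eq_square)
  thus "p = (s / 2 + ?d) * (s / 2 - ?d)" by (simp add: algebra_simps power2_eq_square)
qed

lemma det_pencil:
  assumes "piP A = (a, l + m, l * m)"
  shows "det (mat u - mat v ** A) = (u - v * l) * (u - v * m)"
proof -
  have "A$1$1 + A$2$2 = l + m" "A$1$1 * A$2$2 - A$1$2 * A$2$1 = l * m"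
    using assms by (auto simp: piP_2)
  moreover have "det (mat u - mat v ** A)
      = u * u - u * v * (A$1$1 + A$2$2) + v * v * (A$1$1 * A$2$2 - A$1$2 * A$2$1)"
    by (simp add: det_2 mat_nth mat_matrix_mult_nth algebra_simps)
  ultimately show ?thesis by (simp add: algebra_simps)
qed

lemma contraction_eigenvalues_le:
  assumes "contraction A" "piP A = (a, l + m, l * m)"
  shows "cmod l \<le> 1" "cmod m \<le> 1"
proof -
  have "cmod u \<le> 1" if "u = l \<or> u = m" for u
  proof (rule ccontr)
    assume "\<not> cmod u \<le> 1"
    hence "invertible (mat u - mat 1 ** A)"
      using assms(1) by (intro contraction_pencil_invertible) auto
    thus False using that det_pencil[OF assms(2), of u 1] by (auto simp: invertible_det_nz)
  qed
  thus "cmod l \<le> 1" "cmod m \<le> 1" by auto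
qed

lemma one_minus_mult_nonzero:
  assumes "cmod x \<le> 1" "cmod y < 1"
  shows "1 - x * y \<noteq> 0"
proof -
  have "cmod (x * y) \<le> cmod y" using assms(1) by (simp add: norm_mult mult_left_le_one_le)
  thus ?thesis using assms(2) by auto
qed

lemma cramer_right_2:
  fixes X :: "'a::comm_ring_1^2^2"
  assumes "M ** X = N"
  shows "M$i$1 * det X = N$i$1 * X$2$2 - N$i$2 * X$2$1"
    and "M$i$2 * det X = N$i$2 * X$1$1 - N$i$1 * X$1$2"
  unfolding assms[symmetric] by (simp_all add: det_2 matrix_matrix_mult_def sum_2 algebra_simps)

lemma quadratic_factorization: "1 - (l + m) * z + l * m * z\<^sup>2 = (1 - l * z) * (1 - m * z)"
  for z :: "'a::comm_ring_1"
  by (simp add: algebra_simps power2_eq_square)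

text \<open>The denominator does not vanish if \<open>|z| < 1\<close> and \<open>s = l + m\<close>, \<open>p = l m\<close> with
  \<open>l\<close>, \<open>m\<close> in the closed disc; where it vanishes, the value is \<open>0\<close>.\<close>
definition pentablock_kernel :: "complex \<Rightarrow> complex \<times> complex \<times> complex \<Rightarrow> complex" where
  "pentablock_kernel z = (\<lambda>(a, s, p). a * of_real (1 - (cmod z)\<^sup>2) / (1 - s * z + p * z\<^sup>2))"

lemma pentablock_kernel_roots:
  "pentablock_kernel z (a, l + m, l * m)
    = a * of_real (1 - (cmod z)\<^sup>2) / ((1 - l * z) * (1 - m * z))"
  by (simp add: pentablock_kernel_def quadratic_factorization)

lemma piP_matrix_Moebius:
  assumes "contraction A" "cmod w < 1" "piP A = (a, l + m, l * m)"
  shows "piP (matrix_Moebius w A)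
    = (pentablock_kernel (cnj w) (piP A), Moebius_function 0 w l + Moebius_function 0 w m,
       Moebius_function 0 w l * Moebius_function 0 w m)"
proof -
  define M X where "M = matrix_Moebius w A" and "X = mat 1 - mat (cnj w) ** A"
  have mult_eq: "M ** X = A - mat w"
    unfolding M_def X_def by (rule matrix_Moebius_mult[OF assms(1,2)])
  have det_X: "det X = (1 - l * cnj w) * (1 - m * cnj w)"
    unfolding X_def det_pencil[OF assms(3)] by (simp add: mult.commute)
  have nonzero: "1 - l * cnj w \<noteq> 0" "1 - m * cnj w \<noteq> 0"
    using contraction_eigenvalues_le[OF assms(1,3)] assms(2)
    by (simp_all add: one_minus_mult_nonzero del: right_minus_eq)
  have piP_A: "A$2$1 = a" "A$1$1 + A$2$2 = l + m" "A$1$1 * A$2$2 - A$1$2 * A$2$1 = l * m"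
    using assms(3) by (auto simp: piP_2)
  note cramer = cramer_right_2[OF mult_eq]
  note entries = X_def mat_nth mat_matrix_mult_nth
  have "M$2$1 * det X = a * of_real (1 - (cmod (cnj w))\<^sup>2)"
    unfolding cramer of_real_diff complex_norm_square by (simp add: entries piP_A(1) algebra_simps)
  moreover have "trace M * det X = (l - w) * (1 - m * cnj w) + (m - w) * (1 - l * cnj w)"
  proof -
    have "trace M * det X = (1 + w * cnj w) * (A$1$1 + A$2$2) - 2 * w
        - 2 * cnj w * (A$1$1 * A$2$2 - A$1$2 * A$2$1)"
      unfolding trace_def sum_2 distrib_right cramer by (simp add: entries algebra_simps)
    thus ?thesis unfolding piP_A(2,3) by (simp add: algebra_simps)
  qed
  moreover have "det M * det X = (l - w) * (m - w)"
  proof -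
    have "A - mat w = mat (- w) - mat (- 1) ** A"
      by (simp add: vec_eq_iff mat_nth mat_matrix_mult_nth)
    thus ?thesis by (simp add: det_mul[symmetric] mult_eq det_pencil[OF assms(3)])
  qed
  ultimately show ?thesis
    using nonzero
    unfolding det_X M_def[symmetric] piP_def[of M] assms(3)
      pentablock_kernel_roots Moebius_function_simple mult.commute[of "cnj w"]
    by (simp add: add_frac_eq nonzero_eq_divide_eq del: right_minus_eq)
qed

lemma pentablock_kernel_contraction_le:
  assumes "contraction A" "cmod z < 1"
  shows "cmod (pentablock_kernel z (piP A)) \<le> 1"
proof -
  obtain l m where "trace A = l + m" "det A = l * m" by (rule sum_and_product_of_roots)
  hence "piP A = (A$2$1, l + m, l * m)" by (simp add: piP_def)
  from piP_matrix_Moebius[OF assms(1) _ this, of "cnj z"]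
  have "pentablock_kernel z (piP A) = (matrix_Moebius (cnj z) A)$2$1"
    using assms(2) by (simp add: piP_def)
  also have "cmod \<dots> \<le> 1"
    using assms by (intro contraction_cmod_nth_le contraction_matrix_Moebius) auto
  finally show ?thesis .
qed

subsection \<open>Contractions with prescribed invariants\<close>

lemma trace_zero_scaled_unitary_exists:
  assumes "q \<noteq> 0" "(cmod c)\<^sup>2 \<le> cmod q" "cmod q \<le> 1"
  obtains B where "contraction B" "piP B = (c, 0, q)"
proof -
  define u where "u = csqrt (- q / of_real (cmod q))"
  define d b where "d = u * of_real (sqrt (cmod q - (cmod c)\<^sup>2))" and "b = cnj c * u\<^sup>2"
  define B :: "complex^2^2" where "B = vector [vector [d, b], vector [c, - d]]"
  have u_square: "u\<^sup>2 = - q / of_real (cmod q)" by (simp add: u_def)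
  hence "(cmod u)\<^sup>2 = 1" using assms(1) by (simp add: norm_power[symmetric] norm_divide)
  hence norm_u: "cmod u = 1"
    by (metis norm_ge_zero power2_eq_1_iff neg_0_le_iff_le not_one_le_zero)
  hence u_cnj: "u * cnj u = 1" by (simp add: complex_norm_square[symmetric])
  have d_square: "d\<^sup>2 = u\<^sup>2 * of_real (cmod q - (cmod c)\<^sup>2)"
    unfolding d_def power_mult_distrib of_real_power[symmetric] using assms(2) by simp
  have norm_d: "(cmod d)\<^sup>2 = cmod q - (cmod c)\<^sup>2" and norm_b: "cmod b = cmod c"
    using assms(2) norm_u by (simp_all add: d_def b_def norm_mult norm_power power_mult_distrib)
  have orthogonal: "d * cnj b = c * cnj d"
    using u_cnj by (simp add: d_def b_def power2_eq_square algebra_simps)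
  hence "b * cnj d = d * cnj c"
    by (metis complex_cnj_cnj complex_cnj_mult mult.commute)
  hence "contraction B"
    using assms(3) orthogonal
    by (intro contraction_if_orthogonal_columns)
      (auto simp: B_def forall_2 sum_2 column_def norm_vec_def L2_set_def norm_d norm_b)
  moreover have "d\<^sup>2 + b * c = u\<^sup>2 * (of_real (cmod q - (cmod c)\<^sup>2) + c * cnj c)"
    by (simp add: d_square b_def algebra_simps)
  hence "q = - (d\<^sup>2 + b * c)"
    using assms(1) by (simp add: complex_norm_square[symmetric] u_square)
  hence "piP B = (c, 0, q)" by (simp add: B_def piP_2 power2_eq_square)
  ultimately show ?thesis by (rule that)
qed

lemma trace_zero_contraction_exists:
  assumes "cmod c \<le> 1" "cmod q \<le> 1"
  obtains B where "contraction B" "piP B = (c, 0, q)"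
proof (cases "cmod q \<le> cmod c")
  case True
  define B :: "complex^2^2" where "B = vector [vector [0, - q / c], vector [c, 0]]"
  have "cmod (q / c) \<le> 1" using True by (simp add: norm_divide divide_le_eq_1)
  hence "contraction B"
    using assms(1)
    by (intro contraction_if_orthogonal_columns)
      (auto simp: B_def forall_2 sum_2 column_def norm_vec_def L2_set_def power_le_one)
  moreover have "piP B = (c, 0, q)" using True by (auto simp: B_def piP_2)
  ultimately show ?thesis by (rule that)
next
  case False
  have "(cmod c)\<^sup>2 \<le> cmod c" using assms(1) by (simp add: power2_eq_square mult_left_le)
  with False assms(2) have "q \<noteq> 0" "(cmod c)\<^sup>2 \<le> cmod q" "cmod q \<le> 1" by auto
  thus ?thesis using that by (rule trace_zero_scaled_unitary_exists)
qed

subsection \<open>Hyperbolic midpoints\<close>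

lemma Moebius_function_Moebius_function:
  assumes "cmod c < 1" "cmod x < 1" "cmod y < 1"
  shows "Moebius_function 0 (Moebius_function 0 c y) (Moebius_function 0 c x)
    = (1 - c * cnj y) / (1 - cnj c * y) * Moebius_function 0 y x"
proof -
  have nonzero: "1 - cnj c * x \<noteq> 0" "1 - cnj c * y \<noteq> 0" "1 - c * cnj y \<noteq> 0"
      "1 - cnj y * x \<noteq> 0" "1 - cnj c * c \<noteq> 0"
    using assms by (simp_all add: one_minus_mult_nonzero del: right_minus_eq)
  have "Moebius_function 0 c x - Moebius_function 0 c y
      = (x - y) * (1 - cnj c * c) / ((1 - cnj c * x) * (1 - cnj c * y))"
    using nonzero by (simp add: Moebius_function_simple divide_simps) (simp add: algebra_simps)
  moreover have "1 - cnj (Moebius_function 0 c y) * Moebius_function 0 c x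
      = (1 - cnj y * x) * (1 - cnj c * c) / ((1 - cnj c * x) * (1 - c * cnj y))"
    using nonzero by (simp add: Moebius_function_simple divide_simps) (simp add: algebra_simps)
  ultimately show ?thesis
    using nonzero unfolding Moebius_function_simple[of "Moebius_function 0 c y"]
    by (simp add: Moebius_function_simple[of y])
qed

lemma Moebius_midpoint_of_zero:
  assumes "cmod x < 1"
  obtains u where "cmod u < 1" "Moebius_function 0 u x = u"
proof -
  define t where "t = sqrt (1 - (cmod x)\<^sup>2)"
  define u where "u = x / of_real (1 + t)"
  have "0 \<le> t" and "(cmod x)\<^sup>2 = (1 - t) * (1 + t)"
    using assms by (simp_all add: t_def power_le_one algebra_simps power2_eq_square[symmetric])
  have norm_u: "cmod u = cmod x / (1 + t)"
    unfolding u_def norm_divide norm_of_real using \<open>0 \<le> t\<close> by simp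
  show ?thesis
  proof
    show "cmod u < 1" unfolding norm_u using assms \<open>0 \<le> t\<close> by (simp add: divide_less_eq)
    hence nonzero: "1 - cnj u * x \<noteq> 0" using assms by (intro one_minus_mult_nonzero) auto
    have "(cmod u)\<^sup>2 = (1 - t) / (1 + t)"
      unfolding norm_u power_divide \<open>(cmod x)\<^sup>2 = _\<close> using \<open>0 \<le> t\<close>
      by (simp add: power2_eq_square)
    hence "1 + (cmod u)\<^sup>2 = 2 / (1 + t)" using \<open>0 \<le> t\<close> by (simp add: field_simps)
    hence "x * of_real (1 + (cmod u)\<^sup>2) = 2 * u" by (simp add: u_def)
    hence "x * (1 + u * cnj u) = 2 * u" unfolding of_real_add complex_norm_square by simp
    hence "x - u = u * (1 - cnj u * x)" by (simp add: algebra_simps)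
    thus "Moebius_function 0 u x = u" using nonzero by (simp add: Moebius_function_simple)
  qed
qed

lemma Moebius_midpoint:
  assumes "cmod l < 1" "cmod m < 1"
  obtains w where "cmod w < 1" "Moebius_function 0 w l + Moebius_function 0 w m = 0"
proof -
  define x where "x = Moebius_function 0 l m"
  have "cmod x < 1" unfolding x_def using assms by (rule Moebius_function_norm_lt_1)
  then obtain u where "cmod u < 1" and u_midpoint: "Moebius_function 0 u x = u"
    by (rule Moebius_midpoint_of_zero)
  have m_eq: "Moebius_function 0 (- l) x = m"
    unfolding x_def using assms by (intro Moebius_function_compose) auto
  have l_eq: "Moebius_function 0 (- l) 0 = l" by (simp add: Moebius_function_of_zero)
  note compose = Moebius_function_Moebius_function[of "- l" _ u]
  show ?thesis
  proof
    let ?w = "Moebius_function 0 (- l) u"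
    show "cmod ?w < 1"
      using assms \<open>cmod u < 1\<close> by (intro Moebius_function_norm_lt_1) auto
    show "Moebius_function 0 ?w l + Moebius_function 0 ?w m = 0"
      using compose[of 0] compose[of x] assms(1) \<open>cmod x < 1\<close> \<open>cmod u < 1\<close>
      by (simp add: l_eq m_eq u_midpoint Moebius_function_of_zero)
  qed
qed

lemma contraction_with_piP_exists:
  assumes "cmod l < 1" "cmod m < 1"
    and bound: "\<And>z. cmod z < 1 \<Longrightarrow> cmod (pentablock_kernel z (a, l + m, l * m)) \<le> 1"
  obtains A where "contraction A" "piP A = (a, l + m, l * m)"
proof -
  obtain w where "cmod w < 1" and midpoint: "Moebius_function 0 w l + Moebius_function 0 w m = 0"
    using Moebius_midpoint assms(1,2) by blast
  define l' m' where "l' = Moebius_function 0 w l" and "m' = Moebius_function 0 w m"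
  have less_1: "cmod l' < 1" "cmod m' < 1"
    unfolding l'_def m'_def using assms \<open>cmod w < 1\<close> by (auto intro: Moebius_function_norm_lt_1)
  have inverse: "Moebius_function 0 (- w) l' = l" "Moebius_function 0 (- w) m' = m"
    unfolding l'_def m'_def using assms \<open>cmod w < 1\<close> by (auto intro: Moebius_function_compose)
  define c where "c = pentablock_kernel (cnj w) (a, l + m, l * m)"
  have "cmod c \<le> 1" unfolding c_def using \<open>cmod w < 1\<close> by (intro bound) simp
  moreover have "cmod (l' * m') \<le> 1"
    using norm_mult_less[OF less_1] by simp
  ultimately obtain B where "contraction B" and piP_B: "piP B = (c, l' + m', l' * m')"
    using trace_zero_contraction_exists midpoint unfolding l'_def m'_def by metis
  have "pentablock_kernel (- cnj w) (c, l' + m', l' * m') = a"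
  proof -
    define r where "r = 1 - (cmod w)\<^sup>2"
    have "r > 0" using \<open>cmod w < 1\<close> by (simp add: r_def abs_square_less_1)
    have nonzero: "1 - l * cnj w \<noteq> 0" "1 - m * cnj w \<noteq> 0"
      using assms \<open>cmod w < 1\<close> by (simp_all add: one_minus_mult_nonzero del: right_minus_eq)
    have "1 - l' * - cnj w = of_real r / (1 - l * cnj w)"
      "1 - m' * - cnj w = of_real r / (1 - m * cnj w)"
      unfolding r_def of_real_diff complex_norm_square
      using nonzero by (simp_all add: l'_def m'_def Moebius_function_simple field_simps)
    thus ?thesis
      using nonzero \<open>r > 0\<close>
      unfolding c_def pentablock_kernel_roots norm_minus_cancel complex_mod_cnj r_def[symmetric]
      by (simp del: right_minus_eq)
  qed
  hence "piP (matrix_Moebius (- w) B) = (a, l + m, l * m)"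
    using piP_matrix_Moebius[OF \<open>contraction B\<close> _ piP_B, of "- w"] \<open>cmod w < 1\<close>
    by (simp add: inverse piP_B)
  moreover have "contraction (matrix_Moebius (- w) B)"
    using \<open>contraction B\<close> \<open>cmod w < 1\<close> by (intro contraction_matrix_Moebius) auto
  ultimately show ?thesis using that by blast
qed

subsection \<open>The closure of the domain\<close>

definition dilate :: "real \<Rightarrow> complex \<times> complex \<times> complex \<Rightarrow> complex \<times> complex \<times> complex" where
  "dilate r = (\<lambda>(a, s, p). (of_real r * a, of_real r * s, of_real (r\<^sup>2) * p))"

lemma dilate_piP: "dilate r (piP A) = piP (r *\<^sub>R A)"
  by (simp add: dilate_def piP_2 scaleR_conv_of_real[where 'a=complex] power2_eq_square
      algebra_simps)

lemma dilate_dilate: "dilate r (dilate t x) = dilate (r * t) x"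
  by (cases x) (simp add: dilate_def power_mult_distrib)

lemma dilate_1 [simp]: "dilate 1 x = x"
  by (cases x) (simp add: dilate_def)

lemma closure_if_dilates:
  assumes "\<And>r. 0 < r \<Longrightarrow> r < 1 \<Longrightarrow> dilate r x \<in> S"
  shows "x \<in> closure S"
proof (rule Lim_in_closed_set)
  have "((\<lambda>r. dilate r x) \<longlongrightarrow> dilate 1 x) (at_left 1)"
    unfolding dilate_def case_prod_unfold by (intro tendsto_intros)
  thus "((\<lambda>r. dilate r x) \<longlongrightarrow> x) (at_left 1)" by simp
  have "\<forall>\<^sub>F r :: real in at_left 1. r \<in> {0<..<1}"
    by (intro eventually_at_leftI[of 0]) auto
  thus "\<forall>\<^sub>F r in at_left 1. dilate r x \<in> closure S"
    by eventually_elim (use assms closure_subset in force)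
qed auto

lemma Bmat_contraction: "A \<in> Bmat \<Longrightarrow> contraction A"
  by (simp add: Bmat_def contraction_iff_onorm_le)

lemma scaleR_contraction_in_Bmat:
  assumes "contraction A" "0 \<le> r" "r < 1"
  shows "r *\<^sub>R A \<in> Bmat"
proof -
  have "onorm (\<lambda>v. (r *\<^sub>R A) *v v) = r * onorm ((*v) A)"
    using assms(2) by (simp add: scaleR_matrix_vector_mult onorm_scaleR)
  also have "\<dots> \<le> r * 1"
    using assms by (intro mult_left_mono) (simp_all add: contraction_iff_onorm_le)
  finally show ?thesis using assms(3) by (simp add: Bmat_def)
qed

lemma dilate_piP_contraction_in_Pset:
  assumes "contraction A" "0 \<le> r" "r < 1"
  shows "dilate r (piP A) \<in> Pset"
  unfolding dilate_piP Pset_def using scaleR_contraction_in_Bmat[OF assms] by (rule imageI)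

lemma closure_Pset: "closure Pset = piP ` {A. contraction A}"
proof
  show "closure Pset \<subseteq> piP ` {A. contraction A}"
  proof (rule closure_minimal)
    show "Pset \<subseteq> piP ` {A. contraction A}"
      unfolding Pset_def using Bmat_contraction by blast
    show "closed (piP ` {A. contraction A})"
      by (intro compact_imp_closed compact_continuous_image continuous_on_piP compact_contractions)
  qed
  show "piP ` {A. contraction A} \<subseteq> closure Pset"
    using dilate_piP_contraction_in_Pset by (auto intro!: closure_if_dilates)
qed

lemma dilate_closure_Pset:
  assumes "x \<in> closure Pset" "0 \<le> r" "r < 1"
  shows "dilate r x \<in> Pset"
  using assms dilate_piP_contraction_in_Pset unfolding closure_Pset by blast

lemma pentablock_kernel_dilate_le:
  assumes "0 \<le> r" "r \<le> 1" "cmod z \<le> 1"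
  shows "cmod (pentablock_kernel z (dilate r x)) \<le> cmod (pentablock_kernel (of_real r * z) x)"
proof -
  obtain a s p where x_eq: "x = (a, s, p)" by (cases x)
  define D where "D = 1 - s * (of_real r * z) + p * (of_real r * z)\<^sup>2"
  have "pentablock_kernel z (dilate r x) = a * (of_real r * of_real (1 - (cmod z)\<^sup>2)) / D"
    by (simp add: x_eq dilate_def pentablock_kernel_def D_def power_mult_distrib mult_ac)
  hence "cmod (pentablock_kernel z (dilate r x)) = cmod a * (r * (1 - (cmod z)\<^sup>2)) / cmod D"
    unfolding norm_divide norm_mult norm_of_real using assms
    by (simp add: norm_mult norm_divide power_le_one del: of_real_diff of_real_power)
  also have "\<dots> \<le> cmod a * (1 - (cmod (of_real r * z))\<^sup>2) / cmod D"
  proof (intro divide_right_mono mult_left_mono norm_ge_zero)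
    have "r * (1 - (cmod z)\<^sup>2) \<le> 1 - (cmod z)\<^sup>2"
      using assms by (intro mult_left_le_one_le) (auto simp: power_le_one)
    also have "\<dots> \<le> 1 - (cmod (of_real r * z))\<^sup>2"
      using assms by (intro diff_left_mono power_mono) (auto simp: norm_mult mult_left_le_one_le)
    finally show "r * (1 - (cmod z)\<^sup>2) \<le> 1 - (cmod (of_real r * z))\<^sup>2" .
  qed
  also have "\<dots> = cmod (pentablock_kernel (of_real r * z) x)"
  proof -
    have "(cmod (of_real r * z))\<^sup>2 \<le> 1"
      using assms by (intro power_le_one) (auto simp: norm_mult mult_le_one)
    hence "\<bar>1 - (cmod (of_real r * z))\<^sup>2\<bar> = 1 - (cmod (of_real r * z))\<^sup>2" by simp
    thus ?thesis
      unfolding x_eq pentablock_kernel_def prod.case D_def[symmetric] norm_divide norm_of_real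
        norm_mult[of a] by simp
  qed
  finally show ?thesis .
qed

lemma closure_Pset_iff:
  "(a, l + m, l * m) \<in> closure Pset \<longleftrightarrow> cmod l \<le> 1 \<and> cmod m \<le> 1 \<and>
    (\<forall>z. cmod z < 1 \<longrightarrow> cmod (pentablock_kernel z (a, l + m, l * m)) \<le> 1)"
  (is "?x \<in> _ \<longleftrightarrow> ?conditions")
proof
  assume "?x \<in> closure Pset"
  then obtain A where "contraction A" "piP A = ?x" unfolding closure_Pset by auto
  thus ?conditions
    using contraction_eigenvalues_le pentablock_kernel_contraction_le by metis
next
  assume conditions: ?conditions
  have "dilate r ?x \<in> closure Pset" if r_bounds: "0 < r" "r < 1" for r
  proof -
    define R where "R = complex_of_real r"
    have norm_R: "cmod (R * z) = r * cmod z" for z using r_bounds by (simp add: R_def norm_mult)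
    have dilate_x: "dilate r ?x = (R * a, R * l + R * m, R * l * (R * m))"
      by (simp add: dilate_def R_def power2_eq_square algebra_simps)
    have "cmod (R * l) < 1" "cmod (R * m) < 1"
      unfolding norm_R using conditions r_bounds by (auto intro: le_less_trans[OF mult_left_le])
    moreover have "cmod (pentablock_kernel z (dilate r ?x)) \<le> 1" if "cmod z < 1" for z
    proof -
      have "cmod (pentablock_kernel z (dilate r ?x)) \<le> cmod (pentablock_kernel (R * z) ?x)"
        unfolding R_def using r_bounds that by (intro pentablock_kernel_dilate_le) auto
      also have "cmod (R * z) < 1"
        unfolding norm_R using r_bounds that by (auto intro: le_less_trans[OF mult_left_le_one_le])
      hence "cmod (pentablock_kernel (R * z) ?x) \<le> 1" using conditions by blast
      finally show ?thesis .
    qed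
    ultimately obtain A where "contraction A" "piP A = dilate r ?x"
      unfolding dilate_x using contraction_with_piP_exists by metis
    thus ?thesis unfolding closure_Pset by force
  qed
  thus "?x \<in> closure Pset" using closure_if_dilates[of ?x "closure Pset"] by simp
qed

definition symmetrized_bidisc_cylinder :: "real \<Rightarrow> (complex \<times> complex \<times> complex) set" where
  "symmetrized_bidisc_cylinder C
    = {(a, l + m, l * m) | a l m. cmod a \<le> C \<and> cmod l \<le> 1 \<and> cmod m \<le> 1}"

lemma symmetrized_bidisc_cylinderE:
  assumes "x \<in> symmetrized_bidisc_cylinder C"
  obtains a l m where "x = (a, l + m, l * m)" "cmod l \<le> 1" "cmod m \<le> 1" "cmod a \<le> C"
  using assms unfolding symmetrized_bidisc_cylinder_def by blast

lemma symmetrized_bidisc_cylinder_mono: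
  "C \<le> C' \<Longrightarrow> symmetrized_bidisc_cylinder C \<subseteq> symmetrized_bidisc_cylinder C'"
  unfolding symmetrized_bidisc_cylinder_def using order_trans by blast

lemma closure_Pset_subset_cylinder: "closure Pset \<subseteq> symmetrized_bidisc_cylinder 1"
proof
  fix x assume "x \<in> closure Pset"
  then obtain A where "contraction A" "x = piP A" unfolding closure_Pset by auto
  moreover obtain l m where roots: "trace A = l + m" "det A = l * m" by (rule sum_and_product_of_roots)
  moreover from roots have "piP A = (A$2$1, l + m, l * m)" by (simp add: piP_def)
  ultimately show "x \<in> symmetrized_bidisc_cylinder 1"
    unfolding symmetrized_bidisc_cylinder_def
    using contraction_cmod_nth_le contraction_eigenvalues_le by blast
qed

subsection \<open>Polynomials in three variables\<close>

lemma poly3_monomial: "poly3 (\<lambda>(x, y, z). c * x ^ i * y ^ j * z ^ k)"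
  unfolding poly3_def
proof (intro exI allI)
  fix x y z :: complex
  let ?n = "i + j + k"
  let ?c = "\<lambda>i' j' k'. if (i', j', k') = (i, j, k) then c else 0"
  have "(\<Sum>i'\<le>?n. \<Sum>j'\<le>?n. \<Sum>k'\<le>?n. ?c i' j' k' * x ^ i' * y ^ j' * z ^ k')
      = (\<Sum>t\<in>{..?n} \<times> {..?n} \<times> {..?n}. if t = (i, j, k) then c * x ^ i * y ^ j * z ^ k else 0)"
    unfolding sum.cartesian_product by (intro sum.cong refl) (auto split: if_splits)
  also have "\<dots> = c * x ^ i * y ^ j * z ^ k" by simp
  finally show "(case (x, y, z) of (x, y, z) \<Rightarrow> c * x ^ i * y ^ j * z ^ k)
      = (\<Sum>i'\<le>?n. \<Sum>j'\<le>?n. \<Sum>k'\<le>?n. ?c i' j' k' * x ^ i' * y ^ j' * z ^ k')" by simp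
qed

lemma sum_atMost3_extend:
  fixes n N :: nat
  assumes "n \<le> N"
  shows "(\<Sum>i\<le>n. \<Sum>j\<le>n. \<Sum>k\<le>n. F i j k)
    = (\<Sum>i\<le>N. \<Sum>j\<le>N. \<Sum>k\<le>N. if i \<le> n \<and> j \<le> n \<and> k \<le> n then F i j k else 0)"
  unfolding sum.cartesian_product
  using assms by (intro sum.mono_neutral_cong_left) (auto split: if_splits)

lemma poly3_add:
  assumes "poly3 f" "poly3 g"
  shows "poly3 (\<lambda>x. f x + g x)"
proof -
  obtain n c where f_eq:
    "f (x, y, z) = (\<Sum>i\<le>n. \<Sum>j\<le>n. \<Sum>k\<le>n. c i j k * x ^ i * y ^ j * z ^ k)" for x y z
    using assms(1) unfolding poly3_def by blast
  obtain m d where g_eq: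
    "g (x, y, z) = (\<Sum>i\<le>m. \<Sum>j\<le>m. \<Sum>k\<le>m. d i j k * x ^ i * y ^ j * z ^ k)" for x y z
    using assms(2) unfolding poly3_def by blast
  let ?e = "\<lambda>i j k. (if i \<le> n \<and> j \<le> n \<and> k \<le> n then c i j k else 0)
    + (if i \<le> m \<and> j \<le> m \<and> k \<le> m then d i j k else 0)"
  let ?N = "max n m"
  show ?thesis
    unfolding poly3_def
  proof (intro exI allI)
    fix x y z
    show "f (x, y, z) + g (x, y, z)
        = (\<Sum>i\<le>?N. \<Sum>j\<le>?N. \<Sum>k\<le>?N. ?e i j k * x ^ i * y ^ j * z ^ k)"
      unfolding f_eq g_eq sum_atMost3_extend[of n ?N, simplified]
        sum_atMost3_extend[of m ?N, simplified] sum.distrib[symmetric]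
      by (intro sum.cong refl) (simp add: distrib_right)
  qed
qed

lemma poly3_const: "poly3 (\<lambda>_. c)"
  using poly3_monomial[of c 0 0 0] by (simp add: case_prod_unfold)

lemma poly3_fst: "poly3 (\<lambda>x. fst x)"
  using poly3_monomial[of 1 1 0 0] by (simp add: case_prod_unfold)

lemma poly3_fst_snd: "poly3 (\<lambda>x. fst (snd x))"
  using poly3_monomial[of 1 0 1 0] by (simp add: case_prod_unfold)

lemma poly3_snd_snd: "poly3 (\<lambda>x. snd (snd x))"
  using poly3_monomial[of 1 0 0 1] by (simp add: case_prod_unfold)

lemma poly3_sum: "(\<And>t. t \<in> T \<Longrightarrow> poly3 (f t)) \<Longrightarrow> poly3 (\<lambda>x. \<Sum>t\<in>T. f t x)"
  by (induction T rule: infinite_finite_induct) (simp_all add: poly3_const poly3_add)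

lemma poly3_induct [consumes 1, case_names monomial add]:
  assumes "poly3 f"
    and monomial: "\<And>c i j k. P (\<lambda>(x, y, z). c * x ^ i * y ^ j * z ^ k)"
    and add: "\<And>f g. P f \<Longrightarrow> P g \<Longrightarrow> P (\<lambda>x. f x + g x)"
  shows "P f"
proof -
  obtain n c where f_eq:
    "f (x, y, z) = (\<Sum>i\<le>n. \<Sum>j\<le>n. \<Sum>k\<le>n. c i j k * x ^ i * y ^ j * z ^ k)" for x y z
    using assms(1) unfolding poly3_def by blast
  have "P (\<lambda>_. 0)" using monomial[of 0 0 0 0] by (simp add: case_prod_unfold)
  hence sum: "P (\<lambda>x. \<Sum>t\<in>T. h t x)" if "\<And>t. P (h t)" for T :: "nat set" and h
    by (induction T rule: infinite_finite_induct) (simp_all add: add that)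
  have "P (\<lambda>w. \<Sum>i\<le>n. \<Sum>j\<le>n. \<Sum>k\<le>n. (\<lambda>(x, y, z). c i j k * x ^ i * y ^ j * z ^ k) w)"
    by (intro sum monomial)
  also have "(\<lambda>w. \<Sum>i\<le>n. \<Sum>j\<le>n. \<Sum>k\<le>n. (\<lambda>(x, y, z). c i j k * x ^ i * y ^ j * z ^ k) w) = f"
    by (auto simp: fun_eq_iff f_eq)
  finally show ?thesis .
qed

lemma poly3_mult:
  assumes "poly3 f" "poly3 g"
  shows "poly3 (\<lambda>x. f x * g x)"
  using assms(1)
proof (induction f rule: poly3_induct)
  case (monomial c i j k)
  show ?case using assms(2)
  proof (induction g rule: poly3_induct)
    case (monomial d i' j' k')
    show ?case
      using poly3_monomial[of "c * d" "i + i'" "j + j'" "k + k'"]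
      by (simp add: case_prod_unfold power_add mult_ac)
  qed (simp add: distrib_left poly3_add)
qed (simp add: distrib_right poly3_add)

lemma poly3_diff:
  assumes "poly3 f" "poly3 g" shows "poly3 (\<lambda>x. f x - g x)"
  using poly3_add[OF assms(1) poly3_mult[OF poly3_const[of "-1"] assms(2)]] by simp

lemma poly3_dilate:
  assumes "poly3 f" shows "poly3 (\<lambda>x. f (dilate r x))"
  using assms
proof (induction f rule: poly3_induct)
  case (monomial c i j k)
  show ?case
    using poly3_monomial[of "c * of_real r ^ i * of_real r ^ j * of_real (r\<^sup>2) ^ k" i j k]
    by (simp add: dilate_def case_prod_unfold power_mult_distrib mult_ac)
qed (rule poly3_add)

subsection \<open>Polynomial separation\<close>

definition poly3_separated ::
  "complex \<times> complex \<times> complex \<Rightarrow> (complex \<times> complex \<times> complex) set \<Rightarrow> bool" where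
  "poly3_separated x S \<longleftrightarrow> (\<exists>f. poly3 f \<and> (\<forall>y\<in>S. norm (f y) \<le> 1) \<and> norm (f x) > 1)"

lemma poly3_separated_if_uniform_limit:
  assumes "\<And>n. poly3 (f n)" "uniform_limit (insert x S) f g sequentially"
    and "\<And>y. y \<in> S \<Longrightarrow> cmod (g y) \<le> 1" "cmod (g x) > 1"
  shows "poly3_separated x S"
proof -
  define e where "e = (cmod (g x) - 1) / 3"
  have "e > 0" using assms(4) by (simp add: e_def)
  with assms(2) have "\<forall>\<^sub>F n in sequentially. \<forall>y\<in>insert x S. dist (f n y) (g y) < e"
    by (rule uniform_limitD)
  then obtain n where close: "\<And>y. y \<in> insert x S \<Longrightarrow> cmod (f n y - g y) < e"
    unfolding eventually_sequentially dist_norm by blast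
  define h where "h = (\<lambda>y. of_real (1 / (1 + e)) * f n y)"
  have norm_h: "cmod (h y) = cmod (f n y) / (1 + e)" for y
    unfolding h_def norm_mult norm_of_real using \<open>e > 0\<close> by simp
  have "cmod (h y) \<le> 1" if "y \<in> S" for y
  proof -
    have "cmod (f n y) \<le> cmod (g y) + e"
      using close[of y] that norm_triangle_sub[of "f n y" "g y"] by simp
    thus ?thesis using assms(3)[OF that] \<open>e > 0\<close> by (simp add: norm_h)
  qed
  moreover have "cmod (h x) > 1"
  proof -
    have "cmod (g x) - e < cmod (f n x)"
      using close[of x] norm_triangle_sub[of "g x" "f n x"] by (simp add: norm_minus_commute)
    thus ?thesis using \<open>e > 0\<close> by (simp add: norm_h e_def field_simps)
  qed
  moreover have "poly3 h" unfolding h_def by (intro poly3_mult poly3_const assms(1))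
  ultimately show ?thesis unfolding poly3_separated_def by blast
qed

subsection \<open>Lucas sequences\<close>

text \<open>In terms of the roots, \<open>lucas_U (l + m) (l * m) (Suc n)\<close> is the complete homogeneous
  symmetric polynomial of degree \<open>n\<close>.\<close>
fun lucas_U :: "'a::comm_ring_1 \<Rightarrow> 'a \<Rightarrow> nat \<Rightarrow> 'a" where
  "lucas_U s p 0 = 0"
| "lucas_U s p (Suc 0) = 1"
| "lucas_U s p (Suc (Suc n)) = s * lucas_U s p (Suc n) - p * lucas_U s p n"

lemma poly3_lucas_U: "poly3 (\<lambda>x. lucas_U (fst (snd x)) (snd (snd x)) n)"
  by (induction n rule: induct_nat_012)
    (simp_all add: poly3_const poly3_fst_snd poly3_snd_snd poly3_diff poly3_mult)

lemma lucas_U_Suc: "lucas_U (l + m) (l * m) (Suc n) = l * lucas_U (l + m) (l * m) n + m ^ n"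
  by (induction n rule: induct_nat_012) (simp_all add: algebra_simps)

lemma norm_lucas_U_le:
  fixes l m :: "'a::{real_normed_algebra_1,comm_ring_1}"
  assumes "norm l \<le> 1" "norm m \<le> 1"
  shows "norm (lucas_U (l + m) (l * m) n) \<le> real n"
proof (induction n)
  case (Suc n)
  have "norm (lucas_U (l + m) (l * m) (Suc n))
      \<le> norm l * norm (lucas_U (l + m) (l * m) n) + norm m ^ n"
    unfolding lucas_U_Suc by (intro norm_triangle_le add_mono norm_mult_ineq norm_power_ineq)
  also have "\<dots> \<le> 1 * real n + 1"
    using Suc assms by (intro add_mono mult_mono power_le_one) auto
  finally show ?case by simp
qed simp

lemma lucas_U_partial_sum:
  "(1 - s * z + p * z\<^sup>2) * (\<Sum>n<N. lucas_U s p (Suc n) * z ^ n)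
    = 1 - lucas_U s p (Suc N) * z ^ N + p * lucas_U s p N * z ^ Suc N"
  by (induction N) (simp_all add: algebra_simps power2_eq_square)

lemma summable_Suc_times_power:
  fixes z :: complex
  assumes "cmod z < 1"
  shows "summable (\<lambda>n. real (Suc n) * cmod z ^ n)"
  using geometric_deriv_sums[of "cmod z"] assms by (simp add: sums_iff)

lemma lucas_U_generating_function:
  fixes s p z :: complex
  assumes bound: "\<And>n. cmod (lucas_U s p n) \<le> real n" and "cmod z < 1"
  shows "(\<lambda>n. (1 - s * z + p * z\<^sup>2) * (lucas_U s p (Suc n) * z ^ n)) sums 1"
proof -
  have term_bound: "cmod (lucas_U s p (Suc n) * z ^ n) \<le> real (Suc n) * cmod z ^ n" for n
    unfolding norm_mult norm_power by (intro mult_right_mono bound) simp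
  have "summable (\<lambda>n. lucas_U s p (Suc n) * z ^ n)"
    by (rule summable_comparison_test'[OF summable_Suc_times_power[OF assms(2)]]) (rule term_bound)
  hence limit_0: "(\<lambda>N. lucas_U s p (Suc N) * z ^ N) \<longlonglongrightarrow> 0"
    by (rule summable_LIMSEQ_zero)
  have "(\<lambda>N. lucas_U s p (Suc N) * z ^ Suc (Suc N)) \<longlonglongrightarrow> 0"
    using tendsto_mult_left_zero[OF limit_0, of "z\<^sup>2"] by (simp add: power2_eq_square mult_ac)
  hence "(\<lambda>N. lucas_U s p N * z ^ Suc N) \<longlonglongrightarrow> 0" by (rule LIMSEQ_imp_Suc)
  hence "(\<lambda>N. 1 - lucas_U s p (Suc N) * z ^ N + p * (lucas_U s p N * z ^ Suc N))
      \<longlonglongrightarrow> 1 - 0 + p * 0"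
    by (intro tendsto_intros limit_0)
  thus ?thesis
    unfolding sums_def sum_distrib_left[symmetric] lucas_U_partial_sum by (simp add: mult.assoc)
qed

lemma lucas_U_exceeds:
  fixes l m :: complex
  assumes "cmod l > 1"
  obtains n where "cmod (lucas_U (l + m) (l * m) n) > real n"
proof (rule ccontr)
  assume "\<not> thesis"
  hence "\<And>n. cmod (lucas_U (l + m) (l * m) n) \<le> real n" using that not_le by blast
  moreover have "cmod (1 / l) < 1" using assms by (auto simp: norm_divide divide_less_eq)
  ultimately have "(\<lambda>n. (1 - (l + m) * (1 / l) + l * m * (1 / l)\<^sup>2)
      * (lucas_U (l + m) (l * m) (Suc n) * (1 / l) ^ n)) sums 1"
    by (rule lucas_U_generating_function)
  moreover have "1 - (l + m) * (1 / l) + l * m * (1 / l)\<^sup>2 = 0"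
    unfolding quadratic_factorization using assms by auto
  ultimately have "(\<lambda>n. 0 :: complex) sums 1" by (simp only: mult_zero_left)
  thus False by (simp add: sums_iff)
qed

subsection \<open>Polynomial convexity of the closure\<close>

lemma poly3_separated_if_large_root:
  assumes "cmod l > 1"
  shows "poly3_separated (a, l + m, l * m) (closure Pset)"
proof -
  obtain n where exceeds: "cmod (lucas_U (l + m) (l * m) n) > real n"
    using lucas_U_exceeds[OF assms] .
  hence "n > 0" by (cases n) auto
  define f :: "complex \<times> complex \<times> complex \<Rightarrow> complex"
    where "f = (\<lambda>x. (1 / of_nat n) * lucas_U (fst (snd x)) (snd (snd x)) n)"
  have "poly3 f" unfolding f_def by (intro poly3_mult poly3_const poly3_lucas_U)
  moreover have "cmod (f x) \<le> 1" if "x \<in> closure Pset" for x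
  proof -
    have "x \<in> symmetrized_bidisc_cylinder 1" using that closure_Pset_subset_cylinder by blast
    then obtain b l' m' where x_eq: "x = (b, l' + m', l' * m')" and "cmod l' \<le> 1" "cmod m' \<le> 1"
      by (rule symmetrized_bidisc_cylinderE)
    hence "cmod (lucas_U (l' + m') (l' * m') n) \<le> real n" by (intro norm_lucas_U_le)
    thus ?thesis using \<open>n > 0\<close> by (simp add: f_def x_eq norm_divide)
  qed
  moreover have "cmod (f (a, l + m, l * m)) > 1"
    using exceeds \<open>n > 0\<close> by (simp add: f_def norm_divide)
  ultimately show ?thesis unfolding poly3_separated_def by blast
qed

definition kernel_term :: "complex \<Rightarrow> nat \<Rightarrow> complex \<times> complex \<times> complex \<Rightarrow> complex" where
  "kernel_term z n x =
    fst x * of_real (1 - (cmod z)\<^sup>2) * (lucas_U (fst (snd x)) (snd (snd x)) (Suc n) * z ^ n)"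

lemma poly3_kernel_term: "poly3 (kernel_term z n)"
  unfolding kernel_term_def by (intro poly3_mult poly3_const poly3_fst poly3_lucas_U)

lemma kernel_term_sums:
  assumes "cmod l \<le> 1" "cmod m \<le> 1" "cmod z < 1"
  shows "(\<lambda>n. kernel_term z n (a, l + m, l * m)) sums pentablock_kernel z (a, l + m, l * m)"
proof -
  have "(1 - l * z) * (1 - m * z) \<noteq> 0"
    using assms by (simp add: one_minus_mult_nonzero del: right_minus_eq)
  hence "(\<lambda>n. lucas_U (l + m) (l * m) (Suc n) * z ^ n)
      sums (1 / ((1 - l * z) * (1 - m * z)))"
    using lucas_U_generating_function[OF norm_lucas_U_le[OF assms(1,2)] assms(3)]
    unfolding quadratic_factorization by (intro sums_mult_D)
  from sums_mult[OF this, of "a * of_real (1 - (cmod z)\<^sup>2)"]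
  show ?thesis by (simp add: kernel_term_def pentablock_kernel_roots)
qed

lemma norm_kernel_term_le:
  assumes "cmod l \<le> 1" "cmod m \<le> 1" "cmod z < 1"
  shows "cmod (kernel_term z n (a, l + m, l * m)) \<le> cmod a * (real (Suc n) * cmod z ^ n)"
proof -
  have "\<bar>1 - (cmod z)\<^sup>2\<bar> \<le> 1" using assms(3) by (simp add: power_le_one)
  hence "cmod (kernel_term z n (a, l + m, l * m)) \<le> cmod a * 1 * (real (Suc n) * cmod z ^ n)"
    unfolding kernel_term_def fst_conv snd_conv norm_mult norm_power norm_of_real
    by (intro mult_mono norm_lucas_U_le assms) auto
  thus ?thesis by simp
qed

lemma uniform_limit_pentablock_kernel:
  assumes "cmod z < 1"
  shows "uniform_limit (symmetrized_bidisc_cylinder C)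
    (\<lambda>N x. \<Sum>n<N. kernel_term z n x) (pentablock_kernel z) sequentially"
proof -
  let ?S = "symmetrized_bidisc_cylinder C"
  have "(\<Sum>n. kernel_term z n x) = pentablock_kernel z x" if "x \<in> ?S" for x
  proof -
    from that obtain a l m where "x = (a, l + m, l * m)" "cmod l \<le> 1" "cmod m \<le> 1"
      by (rule symmetrized_bidisc_cylinderE)
    thus ?thesis using kernel_term_sums[OF _ _ assms] by (simp add: sums_iff)
  qed
  hence "uniform_limit ?S (\<lambda>N x. \<Sum>n<N. kernel_term z n x) (pentablock_kernel z) sequentially
      \<longleftrightarrow> uniform_limit ?S (\<lambda>N x. \<Sum>n<N. kernel_term z n x) (\<lambda>x. \<Sum>n. kernel_term z n x) sequentially"
    by (intro uniform_limit_cong') auto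
  also have \<dots>
  proof (rule Weierstrass_m_test)
    show "summable (\<lambda>n. C * (real (Suc n) * cmod z ^ n))"
      by (intro summable_mult summable_Suc_times_power assms)
    fix n x assume "x \<in> ?S"
    then obtain a l m where "x = (a, l + m, l * m)" "cmod l \<le> 1" "cmod m \<le> 1" and "cmod a \<le> C"
      by (rule symmetrized_bidisc_cylinderE)
    hence "cmod (kernel_term z n x) \<le> cmod a * (real (Suc n) * cmod z ^ n)"
      using assms by (simp only: norm_kernel_term_le)
    also have "\<dots> \<le> C * (real (Suc n) * cmod z ^ n)"
      using \<open>cmod a \<le> C\<close> by (intro mult_right_mono) auto
    finally show "cmod (kernel_term z n x) \<le> C * (real (Suc n) * cmod z ^ n)" .
  qed
  finally show ?thesis .
qed

lemma poly3_separated_if_kernel_large: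
  assumes "cmod l \<le> 1" "cmod m \<le> 1" "cmod z < 1"
    and "cmod (pentablock_kernel z (a, l + m, l * m)) > 1"
  shows "poly3_separated (a, l + m, l * m) (closure Pset)"
proof (rule poly3_separated_if_uniform_limit)
  let ?x = "(a, l + m, l * m)"
  let ?C = "max 1 (cmod a)"
  show "poly3 (\<lambda>y. \<Sum>n<N. kernel_term z n y)" for N
    by (intro poly3_sum poly3_kernel_term)
  have "?x \<in> symmetrized_bidisc_cylinder ?C"
    unfolding symmetrized_bidisc_cylinder_def using assms(1,2) by force
  hence "insert ?x (closure Pset) \<subseteq> symmetrized_bidisc_cylinder ?C"
    using closure_Pset_subset_cylinder symmetrized_bidisc_cylinder_mono[of 1 ?C] by auto
  with uniform_limit_pentablock_kernel[OF assms(3)]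
  show "uniform_limit (insert ?x (closure Pset))
      (\<lambda>N y. \<Sum>n<N. kernel_term z n y) (pentablock_kernel z) sequentially"
    by (rule uniform_limit_on_subset)
  show "cmod (pentablock_kernel z y) \<le> 1" if "y \<in> closure Pset" for y
    using that assms(3) pentablock_kernel_contraction_le unfolding closure_Pset by blast
qed (rule assms(4))

lemma closure_Pset_poly3_separated:
  assumes "x \<notin> closure Pset"
  shows "poly3_separated x (closure Pset)"
proof -
  obtain a s p where x_eq: "x = (a, s, p)" by (cases x)
  obtain l m where roots: "s = l + m" "p = l * m" by (rule sum_and_product_of_roots)
  hence swap: "x = (a, m + l, m * l)" by (simp add: x_eq add.commute mult.commute)
  consider (l_large) "cmod l > 1" | (m_large) "cmod m > 1"
    | (kernel_large) z where "cmod l \<le> 1" "cmod m \<le> 1" "cmod z < 1"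
      "cmod (pentablock_kernel z (a, l + m, l * m)) > 1"
    using assms unfolding x_eq roots closure_Pset_iff not_le[symmetric] by blast
  thus ?thesis
  proof cases
    case l_large
    thus ?thesis unfolding x_eq roots by (rule poly3_separated_if_large_root)
  next
    case m_large
    thus ?thesis unfolding swap by (rule poly3_separated_if_large_root)
  next
    case kernel_large
    thus ?thesis unfolding x_eq roots by (rule poly3_separated_if_kernel_large)
  qed
qed

subsection \<open>Polynomial hulls of compact subsets\<close>

lemma open_Bmat: "open Bmat"
proof -
  have "bounded_linear (\<lambda>A :: complex^2^2. Blinfun ((*v) A))"
    unfolding linear_conv_bounded_linear[symmetric]
    by (intro linearI blinfun_eqI)
      (simp_all add: bounded_linear_Blinfun_apply blinfun.bilinear_simps
        matrix_vector_mult_add_rdistrib scaleR_matrix_vector_mult)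
  hence "open {A :: complex^2^2. norm (Blinfun ((*v) A)) < 1}"
    by (intro open_Collect_less continuous_intros linear_continuous_on)
  thus ?thesis
    by (simp add: Bmat_def norm_blinfun.rep_eq bounded_linear_Blinfun_apply)
qed

lemma open_image_power2:
  fixes S :: "complex set"
  assumes "open S"
  shows "open ((\<lambda>z. z\<^sup>2) ` S)"
proof (rule open_mapping_thm[where S = UNIV])
  show "\<not> (\<lambda>z :: complex. z\<^sup>2) constant_on UNIV"
    unfolding constant_on_def by (metis UNIV_I power_one zero_neq_one zero_power2)
qed (use assms in \<open>auto intro!: holomorphic_intros\<close>)

definition diagonal_shift_matrix :: "complex \<Rightarrow> (complex \<times> complex) \<times> complex \<Rightarrow> complex^2^2" where
  "diagonal_shift_matrix b = (\<lambda>((h, a), d). vector [vector [h + d, b], vector [a, h - d]])"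

lemma continuous_on_diagonal_shift_matrix: "continuous_on S (diagonal_shift_matrix b)"
proof -
  have "continuous_on S (\<lambda>t. diagonal_shift_matrix b t $ i $ j)" for i j
    using exhaust_2[of i] exhaust_2[of j]
    by (auto simp: diagonal_shift_matrix_def case_prod_unfold continuous_intros)
  hence "continuous_on S (\<lambda>t. \<chi> i j. diagonal_shift_matrix b t $ i $ j)"
    by (intro continuous_on_vec_lambda)
  thus ?thesis by simp
qed

lemma piP_diagonal_shift_matrix:
  "piP (diagonal_shift_matrix b ((h, a), d)) = (a, 2 * h, h\<^sup>2 - d\<^sup>2 - b * a)"
  by (simp add: diagonal_shift_matrix_def piP_2 algebra_simps power2_eq_square)

text \<open>With the entry \<open>b\<close> of \<open>[[h + d, b], [a, h - d]]\<close> kept fixed, \<open>h\<close>, \<open>a\<close> and \<open>d\<^sup>2\<close> are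
  polynomials in the image under \<open>piP\<close>, and squaring is an open map.\<close>
lemma open_Pset: "open Pset"
proof (subst open_subopen, intro ballI)
  fix x assume "x \<in> Pset"
  then obtain A where "A \<in> Bmat" "x = piP A" unfolding Pset_def by blast
  define b h d where "b = A$1$2" and "h = (A$1$1 + A$2$2) / 2" and "d = (A$1$1 - A$2$2) / 2"
  have A_eq: "A = diagonal_shift_matrix b ((h, A$2$1), d)"
    by (simp add: diagonal_shift_matrix_def h_def d_def b_def vec_eq_iff forall_2 field_simps)
  have "open (diagonal_shift_matrix b -` Bmat)"
    by (intro open_vimage open_Bmat continuous_on_diagonal_shift_matrix)
  moreover have "((h, A$2$1), d) \<in> diagonal_shift_matrix b -` Bmat"
    using \<open>A \<in> Bmat\<close> A_eq by simp
  ultimately obtain U D where box: "open U" "open D" "((h, A$2$1), d) \<in> U \<times> D"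
      "U \<times> D \<subseteq> diagonal_shift_matrix b -` Bmat"
    by (rule open_prod_elim)
  define \<psi> where "\<psi> = (\<lambda>(a, s, p). ((s / 2, a), (s / 2)\<^sup>2 - p - b * a))"
  define T where "T = \<psi> -` (U \<times> (\<lambda>z. z\<^sup>2) ` D)"
  have "open T"
    unfolding T_def \<psi>_def case_prod_unfold
    by (intro open_vimage open_Times open_image_power2 box continuous_intros) auto
  moreover have "x \<in> T"
  proof -
    have "\<psi> x = ((h, A$2$1), d\<^sup>2)"
      unfolding \<open>x = piP A\<close> by (subst A_eq) (simp add: piP_diagonal_shift_matrix \<psi>_def)
    thus ?thesis using box(3) by (simp add: T_def)
  qed
  moreover have "T \<subseteq> Pset"
  proof
    fix y assume "y \<in> T"
    moreover obtain a s p where y_eq: "y = (a, s, p)" by (cases y)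
    ultimately obtain e where "e \<in> D" "(s / 2, a) \<in> U"
      and e_square: "e\<^sup>2 = (s / 2)\<^sup>2 - p - b * a"
      by (auto simp: T_def \<psi>_def)
    hence "diagonal_shift_matrix b ((s / 2, a), e) \<in> Bmat" using box(4) by auto
    moreover have "y = piP (diagonal_shift_matrix b ((s / 2, a), e))"
      by (simp add: y_eq piP_diagonal_shift_matrix e_square)
    ultimately show "y \<in> Pset" unfolding Pset_def by blast
  qed
  ultimately show "\<exists>T. open T \<and> x \<in> T \<and> T \<subseteq> Pset" by blast
qed

lemma compact_subset_open_dilate:
  assumes "compact K" "open S" "K \<subseteq> S"
  obtains r where "r > 1" "dilate r ` K \<subseteq> S"
proof -
  define W where "W = (\<lambda>(r, x). dilate r x) -` S"
  have "open W"
    unfolding W_def dilate_def case_prod_unfold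
    by (intro open_vimage assms(2) continuous_intros)
  moreover have "{1} \<times> K \<subseteq> W" using assms(3) by (auto simp: W_def)
  ultimately have "\<exists>U. 1 \<in> U \<and> open U \<and> U \<times> K \<subseteq> W"
    by (rule Elementary_Topology.tube_lemma[OF assms(1)])
  then obtain U where "1 \<in> U" "open U" and tube: "U \<times> K \<subseteq> W" by blast
  then obtain e where "e > 0" "cball 1 e \<subseteq> U"
    using open_contains_cball by blast
  hence "1 + e \<in> U" by (auto simp: subset_iff dist_norm)
  hence "dilate (1 + e) ` K \<subseteq> S" using tube by (auto simp: W_def)
  thus ?thesis using \<open>e > 0\<close> by (intro that) auto
qed

lemma poly_hull_dilate:
  assumes "x \<in> poly_hull K"
  shows "dilate r x \<in> poly_hull (dilate r ` K)"
  unfolding poly_hull_def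
proof (intro CollectI allI impI)
  fix f M assume "poly3 f" "\<forall>k\<in>dilate r ` K. cmod (f k) \<le> M"
  hence "poly3 (\<lambda>y. f (dilate r y))" "\<forall>k\<in>K. cmod (f (dilate r k)) \<le> M"
    by (simp_all add: poly3_dilate)
  thus "cmod (f (dilate r x)) \<le> M" using assms unfolding poly_hull_def by blast
qed

lemma poly_hull_subset_if_separated:
  assumes "\<And>x. x \<notin> S \<Longrightarrow> poly3_separated x S" "K \<subseteq> S"
  shows "poly_hull K \<subseteq> S"
proof (rule subsetI, rule ccontr)
  fix x assume hull: "x \<in> poly_hull K" and "x \<notin> S"
  then obtain f where "poly3 f" "\<forall>y\<in>S. cmod (f y) \<le> 1" "cmod (f x) > 1"
    using assms(1) unfolding poly3_separated_def by blast
  moreover from this have "cmod (f x) \<le> 1"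
    using hull assms(2) unfolding poly_hull_def by blast
  ultimately show False by simp
qed

theorem theorem6p3:
  shows "(\<forall>x. x \<notin> closure Pset \<longrightarrow>
            (\<exists>f. poly3 f \<and> (\<forall>p\<in>closure Pset. norm (f p) \<le> 1) \<and> norm (f x) > 1))
       \<and> (\<forall>K. compact K \<and> K \<subseteq> Pset \<longrightarrow> poly_hull K \<subseteq> Pset)"
proof (intro conjI allI impI subsetI)
  fix x assume "x \<notin> closure Pset"
  thus "\<exists>f. poly3 f \<and> (\<forall>p\<in>closure Pset. norm (f p) \<le> 1) \<and> norm (f x) > 1"
    using closure_Pset_poly3_separated unfolding poly3_separated_def by blast
next
  fix K x assume "compact K \<and> K \<subseteq> Pset" and "x \<in> poly_hull K"
  then obtain r where "r > 1" and dilated: "dilate r ` K \<subseteq> Pset"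
    using open_Pset compact_subset_open_dilate by blast
  have "dilate r x \<in> poly_hull (dilate r ` K)"
    using \<open>x \<in> poly_hull K\<close> by (rule poly_hull_dilate)
  also have "\<dots> \<subseteq> closure Pset"
    using closure_Pset_poly3_separated order_trans[OF dilated closure_subset]
    by (rule poly_hull_subset_if_separated)
  finally have "dilate (1 / r) (dilate r x) \<in> Pset"
    using \<open>r > 1\<close> by (intro dilate_closure_Pset) auto
  thus "x \<in> Pset" using \<open>r > 1\<close> by (simp add: dilate_dilate)
qed

end
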